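(* Let $T>0$, let $M\ge1$ be an integer, let $\mu:[0,T]\to[0,\infty)$ be an integrable function (the follower's feed message intensity due to other broadcasters), and let $k\ge1$ be an integer. Let $\mathcal G$ be the space of piecewise constant functions $\lambda:[0,T]\to\mathbb R$ of the form $$ \lambda(t)=\sum_{m=1}^M a_m\,\mathbb I(\tau_{m-1}\le t<\tau_m),\qquad a_m\ge0,\quad \tau_0=0,\quad \tau_m-\tau_{m-1}=T/M . $$ For $\lambda\in\mathcal G$ define $$ f_k(t)[\lambda]=\frac{1}{(k-1)!}\int_0^t \lambda(\tau)\, e^{-\int_\tau^t \lambda(x)\,dx}\;\Gamma\!\left[k,\int_\tau^t\mu(x)\,dx\right]d\tau \quad (t\in[0,T]),\qquad \mathcal V(k)[\lambda]=\int_0^T f_k(t)[\lambda]\,dt, $$ where $\Gamma[k,x]=\int_x^\infty s^{k-1}e^{-s}\,ds$. Then, for every $t\in[0,T]$, the functional $\lambda\mapsto f_k(t)[\lambda]$ is concave on $\mathcal G$, and the functional $\lambda\mapsto \mathcal V(k)[\lambda]$ is concave on $\mathcal G$.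
   Context: A functional $J:\mathcal G\to\mathbb R$ is concave if for all $g_1,g_2\in\mathcal G$ and all $0<\alpha<1$, $J[\alpha g_1+(1-\alpha)g_2]\ge \alpha J[g_1]+(1-\alpha)J[g_2]$. $\mathbb I(\cdot)$ is the indicator function. $f_k(t)[\lambda]$ is the probability that at least one message from a broadcaster with message intensity $\lambda$ is among the $k$ most recent messages received at time $t$ by a follower whose feed intensity due to other broadcasters is $\mu$, and $\mathcal V(k)$ is the expected amount of time in $[0,T]$ during which this happens. *)

theory Defs
  imports "HOL-Analysis.Analysis"
begin

(* The function type carries no real_vector instance, so concave_on does not apply. *)
definition concave_functional :: "(real \<Rightarrow> real) set \<Rightarrow> ((real \<Rightarrow> real) \<Rightarrow> real) \<Rightarrow> bool" where
  "concave_functional G J \<longleftrightarrow>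
     (\<forall>g1\<in>G. \<forall>g2\<in>G. \<forall>\<alpha>. 0 < \<alpha> \<and> \<alpha> < 1 \<longrightarrow>
        J (\<lambda>x. \<alpha> * g1 x + (1 - \<alpha>) * g2 x) \<ge> \<alpha> * J g1 + (1 - \<alpha>) * J g2)"

definition breakpoint :: "real \<Rightarrow> nat \<Rightarrow> nat \<Rightarrow> real" where
  "breakpoint T M m = real m * (T / real M)"

(* Members are functions on [0,T]: their values outside [0,T] are unconstrained and irrelevant
   below.  As the last piece is half-open, they vanish at T. *)
definition piecewise_constant_intensities :: "real \<Rightarrow> nat \<Rightarrow> (real \<Rightarrow> real) set" where
  "piecewise_constant_intensities T M =
     {l. \<exists>a :: nat \<Rightarrow> real. (\<forall>m\<in>{1..M}. 0 \<le> a m) \<and>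
        (\<forall>t\<in>{0..T}. l t =
           (\<Sum>m = 1..M. a m * indicator {breakpoint T M (m - 1)..<breakpoint T M m} t))}"

definition upper_Gamma :: "nat \<Rightarrow> real \<Rightarrow> real" where
  "upper_Gamma k x = (LINT s:{x..}|lebesgue. s ^ (k - 1) * exp (- s))"

definition visibility_prob :: "(real \<Rightarrow> real) \<Rightarrow> nat \<Rightarrow> real \<Rightarrow> (real \<Rightarrow> real) \<Rightarrow> real" where
  "visibility_prob \<mu> k t l =
     1 / fact (k - 1) *
     (LINT \<tau>:{0..t}|lebesgue.
        l \<tau> * exp (- (LINT x:{\<tau>..t}|lebesgue. l x)) *
        upper_Gamma k (LINT x:{\<tau>..t}|lebesgue. \<mu> x))"

definition visibility :: "real \<Rightarrow> (real \<Rightarrow> real) \<Rightarrow> nat \<Rightarrow> (real \<Rightarrow> real) \<Rightarrow> real" where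
  "visibility T \<mu> k l = (LINT t:{0..T}|lebesgue. visibility_prob \<mu> k t l)"

end

theory Submission
  imports Defs
begin

text \<open>
  The density \<open>\<lambda>(\<tau>) exp (-\<integral>\<^sub>\<tau>\<^sup>t \<lambda>)\<close> is the derivative in \<open>\<tau>\<close> of \<open>exp (-\<integral>\<^sub>\<tau>\<^sup>t \<lambda>)\<close>, so its integral over a
  tail \<open>[c, t]\<close> is \<open>1 - exp (-\<integral>\<^sub>c\<^sup>t \<lambda>)\<close>, which is concave in \<open>\<lambda>\<close> for every \<open>c\<close>. The factor
  \<open>\<Gamma>[k, \<integral>\<^sub>\<tau>\<^sup>t \<mu>]\<close> is nonnegative and nondecreasing in \<open>\<tau>\<close>, and by the second mean value theorem an
  integral against such a weight inherits the sign of the tail integrals. This yields concavity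
  of \<open>f\<^sub>k(t)\<close>, and integrating over \<open>t\<close> that of \<open>V(k)\<close>; as the library integral of a non-integrable
  function is \<open>0\<close>, the latter requires \<open>f\<^sub>k\<close> to be bounded and measurable in \<open>t\<close>.
\<close>

section \<open>Admissible intensities on the real line\<close>

text \<open>A class stable under convex combinations: boundedness and Borel measurability make every
  member integrable on compact intervals, and continuity off a finite set is what the fundamental
  theorem of calculus asks for.\<close>

definition admissible_intensity :: "(real \<Rightarrow> real) \<Rightarrow> bool" where
  "admissible_intensity l \<longleftrightarrow>
     (\<forall>x. 0 \<le> l x) \<and> (\<exists>B. \<forall>x. l x \<le> B) \<and> (\<exists>S. finite S \<and> continuous_on (- S) l)"

lemma admissible_intensity_nonneg: "admissible_intensity l \<Longrightarrow> 0 \<le> l x"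
  by (simp add: admissible_intensity_def)

lemma admissible_intensity_borel_measurable:
  assumes "admissible_intensity l"
  shows "l \<in> borel_measurable borel"
  using assms borel_measurable_continuous_countable_exceptions countable_finite
  unfolding admissible_intensity_def by blast

lemma admissible_intensity_absolutely_integrable:
  assumes "admissible_intensity l"
  shows "l absolutely_integrable_on {a..b::real}"
proof -
  have "l \<in> borel_measurable lebesgue"
    using admissible_intensity_borel_measurable[OF assms] by (simp add: measurable_completion)
  then have *: "l \<in> borel_measurable (lebesgue_on {a..b})"
    by (simp add: measurable_restrict_space1)
  obtain B where "\<And>x. norm (l x) \<le> B"
    using assms unfolding admissible_intensity_def by (auto simp: abs_of_nonneg)
  then show ?thesis
    by (intro measurable_bounded_by_integrable_imp_absolutely_integrable[OF *, where g = "\<lambda>_. B"]) auto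
qed

lemma admissible_intensity_integrable:
  "admissible_intensity l \<Longrightarrow> l integrable_on {a..b::real}"
  using admissible_intensity_absolutely_integrable absolutely_integrable_on_def by blast

lemma admissible_intensity_convex:
  assumes "admissible_intensity l1" "admissible_intensity l2" "0 \<le> \<alpha>" "\<alpha> \<le> 1"
  shows "admissible_intensity (\<lambda>x. \<alpha> * l1 x + (1 - \<alpha>) * l2 x)"
proof -
  obtain S1 S2 where S: "finite S1" "continuous_on (- S1) l1" "finite S2" "continuous_on (- S2) l2"
    using assms unfolding admissible_intensity_def by blast
  have "continuous_on (- (S1 \<union> S2)) (\<lambda>x. \<alpha> * l1 x + (1 - \<alpha>) * l2 x)"
    by (intro continuous_intros; rule continuous_on_subset[OF S(2)] continuous_on_subset[OF S(4)]; blast)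
  moreover obtain B1 B2 where B: "\<And>x. l1 x \<le> B1" "\<And>x. l2 x \<le> B2"
    using assms unfolding admissible_intensity_def by blast
  then have "\<alpha> * l1 x + (1 - \<alpha>) * l2 x \<le> \<alpha> * B1 + (1 - \<alpha>) * B2" for x
    using assms by (intro add_mono mult_left_mono) auto
  ultimately show ?thesis
    using assms S unfolding admissible_intensity_def
    by (intro conjI allI exI[of _ "S1 \<union> S2"] exI[of _ "\<alpha> * B1 + (1 - \<alpha>) * B2"]) auto
qed

section \<open>Survival density and weighted tail integrals\<close>

text \<open>Fundamental theorem of calculus for the primitive
  \<open>exp (- integral {\<tau>..b} l)\<close>, which is continuous on the whole interval and
  differentiable off the finite exceptional set.\<close>

lemma has_integral_survival_density:
  fixes a b :: real
  assumes "admissible_intensity l" "a \<le> b"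
  shows "((\<lambda>\<tau>. l \<tau> * exp (- integral {\<tau>..b} l)) has_integral (1 - exp (- integral {a..b} l))) {a..b}"
proof -
  obtain S where S: "finite S" "continuous_on (- S) l"
    using assms unfolding admissible_intensity_def by blast
  have int: "l integrable_on {c..d}" for c d
    using assms(1) by (rule admissible_intensity_integrable)
  have "((\<lambda>\<tau>. l \<tau> * exp (- integral {\<tau>..b} l)) has_integral
          (exp (- integral {b..b} l) - exp (- integral {a..b} l))) {a..b}"
  proof (rule fundamental_theorem_of_calculus_interior_strong[OF S(1) \<open>a \<le> b\<close>])
    show "continuous_on {a..b} (\<lambda>\<tau>. exp (- integral {\<tau>..b} l))"
      by (intro continuous_intros indefinite_integral_continuous_1' int)
  next
    fix x assume x: "x \<in> {a<..<b} - S"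
    have "((\<lambda>u. integral {a..u} l) has_vector_derivative l x) (at x within ({a..b} - S))"
      using x S by (intro integral_has_vector_derivative_continuous_at int)
        (auto intro: continuous_on_imp_continuous_within[of "- S"] continuous_on_subset)
    \<comment> \<open>Openness turns the one-set derivative into a full derivative at
      \<open>x\<close>.\<close>
    moreover have op: "open ({a<..<b} - S)"
      using S by (simp add: finite_imp_closed open_Diff)
    ultimately have "((\<lambda>u. integral {a..u} l) has_real_derivative l x) (at x within ({a<..<b} - S))"
      unfolding has_real_derivative_iff_has_vector_derivative
      by (rule_tac has_vector_derivative_within_subset) auto
    then have "((\<lambda>u. integral {a..u} l) has_real_derivative l x) (at x)"
      using at_within_open[OF x op] by simp
    \<comment> \<open>The variable lower limit is traded for a variable upper one, whose derivative
      is known.\<close>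
    then have "((\<lambda>u. exp (- (integral {a..b} l - integral {a..u} l))) has_real_derivative
        l x * exp (- (integral {a..b} l - integral {a..x} l))) (at x)"
      by (auto intro!: derivative_eq_intros)
    moreover have eq: "integral {u..b} l = integral {a..b} l - integral {a..u} l" if "u \<in> {a<..<b}" for u
      using Henstock_Kurzweil_Integration.integral_combine[OF _ _ int, of a u b] that by simp
    ultimately have "((\<lambda>u. exp (- integral {u..b} l)) has_real_derivative
        l x * exp (- (integral {a..b} l - integral {a..x} l))) (at x)"
      using x by (rule_tac has_field_derivative_transform_within_open[where S = "{a<..<b}"]) auto
    then show "((\<lambda>u. exp (- integral {u..b} l)) has_vector_derivative
        l x * exp (- integral {x..b} l)) (at x)"
      using x by (simp add: has_real_derivative_iff_has_vector_derivative eq)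
  qed
  then show ?thesis by simp
qed

text \<open>The second mean value theorem expresses the integral through \<open>g a\<close> and
  \<open>g b\<close>. Regrouped, it is \<open>g a\<close> times the full integral plus
  \<open>g b - g a\<close> times a tail, and all four factors are nonnegative.\<close>

lemma integral_mult_increasing_nonneg:
  fixes w g :: "real \<Rightarrow> real"
  assumes "w integrable_on {a..b}" "a \<le> b"
    and g: "\<And>x y. \<lbrakk>a \<le> x; x \<le> y; y \<le> b\<rbrakk> \<Longrightarrow> g x \<le> g y"
    and "0 \<le> g a"
    and tail: "\<And>c. c \<in> {a..b} \<Longrightarrow> 0 \<le> integral {c..b} w"
  shows "0 \<le> integral {a..b} (\<lambda>x. g x * w x)"
proof -
  obtain c where c: "c \<in> {a..b}"
      "integral {a..b} (\<lambda>x. g x * w x) = g a * integral {a..c} w + g b * integral {c..b} w"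
    using second_mean_value_theorem[where f = w and g = g, OF assms(1,2) g] by blast
  have "integral {a..c} w + integral {c..b} w = integral {a..b} w"
    using c assms by (intro Henstock_Kurzweil_Integration.integral_combine) auto
  then have "integral {a..b} (\<lambda>x. g x * w x)
      = g a * integral {a..b} w + (g b - g a) * integral {c..b} w"
    using c(2) by (simp add: algebra_simps flip: distrib_left)
  also have "\<dots> \<ge> 0"
    using assms c(1) g[of a b] by simp
  finally show ?thesis .
qed

section \<open>The incomplete Gamma function\<close>

lemma set_integrable_Gamma_integrand:
  assumes "k \<ge> 1" "0 \<le> x"
  shows "set_integrable lebesgue {x..} (\<lambda>s::real. s ^ (k - 1) * exp (- s))"
proof -
  have "((\<lambda>t. t powr (real k - 1) / exp t) has_integral Gamma (real k)) {0..}"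
    using assms by (intro Gamma_integral_real) auto
  then have "(\<lambda>t. t powr (real k - 1) / exp t) absolutely_integrable_on {0..}"
    by (intro nonnegative_absolutely_integrable_1) (auto simp: has_integral_integrable)
  \<comment> \<open>The point 0 is dropped because for \<open>k = 1\<close> the two integrands
    differ there: \<open>0 powr 0 = 0\<close>, but \<open>0 ^ 0 = 1\<close>. It is put back below as
    a null set.\<close>
  then have "(\<lambda>t. t powr (real k - 1) / exp t) absolutely_integrable_on {0<..}"
    by (rule set_integrable_subset) auto
  moreover have "t powr (real k - 1) / exp t = t ^ (k - 1) * exp (- t)" if "t \<in> {0<..}" for t
    using that assms by (simp add: exp_minus field_simps powr_realpow[symmetric] of_nat_diff)
  ultimately have "(\<lambda>t::real. t ^ (k - 1) * exp (- t)) absolutely_integrable_on {0<..}"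
    by (subst set_integrable_cong) auto
  then have "(\<lambda>t::real. t ^ (k - 1) * exp (- t)) absolutely_integrable_on {0..}"
    by (rule absolutely_integrable_spike_set)
       (auto intro: negligible_subset[of "{0}"])
  then show ?thesis
    by (rule set_integrable_subset) (use assms in auto)
qed

lemma upper_Gamma_antimono:
  assumes "k \<ge> 1" "0 \<le> x" "x \<le> y"
  shows "upper_Gamma k y \<le> upper_Gamma k x"
proof -
  have "upper_Gamma k z = integral {z..} (\<lambda>s. s ^ (k - 1) * exp (- s))" if "0 \<le> z" for z
    unfolding upper_Gamma_def
    using assms that by (intro set_lebesgue_integral_eq_integral set_integrable_Gamma_integrand)
  then show ?thesis
    using assms set_lebesgue_integral_eq_integral(1)[OF set_integrable_Gamma_integrand[OF \<open>k \<ge> 1\<close>]]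
    by (auto intro!: integral_subset_le)
qed

lemma upper_Gamma_nonneg:
  assumes "0 \<le> x"
  shows "0 \<le> upper_Gamma k x"
  unfolding upper_Gamma_def set_lebesgue_integral_def
  using assms by (intro integral_nonneg_AE) (auto split: split_indicator)

section \<open>Concavity of the visibility probability at a fixed time\<close>

text \<open>For a Poisson process of rate \<open>l\<close>, the density of the time of the last
  message before \<open>t\<close>.\<close>

definition intensity_density :: "(real \<Rightarrow> real) \<Rightarrow> real \<Rightarrow> real \<Rightarrow> real" where
  "intensity_density l t \<tau> = l \<tau> * exp (- integral {\<tau>..t} l)"

lemma intensity_density_nonneg: "admissible_intensity l \<Longrightarrow> 0 \<le> intensity_density l t \<tau>"
  by (simp add: intensity_density_def admissible_intensity_nonneg)

lemma integral_feed_antimono: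
  fixes \<mu> :: "real \<Rightarrow> real"
  assumes "\<forall>t\<in>{0..T}. 0 \<le> \<mu> t" and "set_integrable lebesgue {0..T} \<mu>"
    and "0 \<le> x" "x \<le> y" "t \<le> T"
  shows "0 \<le> (LINT s:{y..t}|lebesgue. \<mu> s)"
    and "(LINT s:{y..t}|lebesgue. \<mu> s) \<le> (LINT s:{x..t}|lebesgue. \<mu> s)"
proof -
  have int: "set_integrable lebesgue {z..t} \<mu>" if "z \<ge> 0" for z
    using assms that by (intro set_integrable_subset[OF assms(2)]) auto
  note eq = set_lebesgue_integral_eq_integral[OF int]
  show "(LINT s:{y..t}|lebesgue. \<mu> s) \<le> (LINT s:{x..t}|lebesgue. \<mu> s)"
    using assms by (auto simp: eq intro!: integral_subset_le)
  show "0 \<le> (LINT s:{y..t}|lebesgue. \<mu> s)"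
    using assms by (auto simp: eq intro!: integral_nonneg)
qed

text \<open>A composition of two decreasing maps: a later start leaves less competing feed, and less
  feed means a larger \<Gamma> value. This is the monotone weight for the second mean value
  theorem.\<close>

lemma upper_Gamma_feed_mono:
  fixes \<mu> :: "real \<Rightarrow> real"
  assumes "k \<ge> 1" and "\<forall>t\<in>{0..T}. 0 \<le> \<mu> t" and "set_integrable lebesgue {0..T} \<mu>"
    and "0 \<le> x" "x \<le> y" "t \<le> T"
  shows "upper_Gamma k (LINT s:{x..t}|lebesgue. \<mu> s) \<le> upper_Gamma k (LINT s:{y..t}|lebesgue. \<mu> s)"
  using assms integral_feed_antimono[OF assms(2-6)] by (intro upper_Gamma_antimono) auto

text \<open>The full second mean value theorem also asserts that a monotone function times an
  integrable one is integrable. Nonnegativity then upgrades this to absolute integrability.\<close>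

lemma integrable_upper_Gamma_intensity_density:
  fixes \<mu> :: "real \<Rightarrow> real"
  assumes "k \<ge> 1" and "\<forall>t\<in>{0..T}. 0 \<le> \<mu> t" and "set_integrable lebesgue {0..T} \<mu>"
    and "t \<in> {0..T}" and l: "admissible_intensity l"
  shows "(\<lambda>\<tau>. upper_Gamma k (LINT x:{\<tau>..t}|lebesgue. \<mu> x) * intensity_density l t \<tau>)
           absolutely_integrable_on {0..t}"
proof (rule nonnegative_absolutely_integrable_1)
  have "(intensity_density l t) integrable_on {0..t}"
    using has_integral_survival_density[OF l, of 0 t] assms
    unfolding intensity_density_def by auto
  moreover have "0 \<le> t"
    using assms(4) by simp
  moreover have "upper_Gamma k (LINT s:{x..t}|lebesgue. \<mu> s) \<le> upper_Gamma k (LINT s:{y..t}|lebesgue. \<mu> s)"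
    if "0 \<le> x" "x \<le> y" "y \<le> t" for x y
    using upper_Gamma_feed_mono[OF assms(1-3)] assms(4) that by simp
  ultimately obtain c where "((\<lambda>\<tau>. upper_Gamma k (LINT x:{\<tau>..t}|lebesgue. \<mu> x) * intensity_density l t \<tau>)
      has_integral (upper_Gamma k (LINT x:{0..t}|lebesgue. \<mu> x) * integral {0..c} (intensity_density l t)
        + upper_Gamma k (LINT x:{t..t}|lebesgue. \<mu> x) * integral {c..t} (intensity_density l t))) {0..t}"
    by (rule second_mean_value_theorem_full[where
          g = "\<lambda>\<tau>. upper_Gamma k (LINT x:{\<tau>..t}|lebesgue. \<mu> x)"])
  then show "(\<lambda>\<tau>. upper_Gamma k (LINT x:{\<tau>..t}|lebesgue. \<mu> x) * intensity_density l t \<tau>)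
      integrable_on {0..t}"
    by (rule has_integral_integrable)
next
  fix \<tau> assume "\<tau> \<in> {0..t}"
  then show "0 \<le> upper_Gamma k (LINT x:{\<tau>..t}|lebesgue. \<mu> x) * intensity_density l t \<tau>"
    using assms integral_feed_antimono(1)[OF assms(2,3), of \<tau> \<tau> t]
    by (auto intro!: mult_nonneg_nonneg upper_Gamma_nonneg intensity_density_nonneg)
qed

text \<open>Passes from Lebesgue to gauge integrals, for which the second mean value theorem is
  stated.\<close>

lemma visibility_prob_eq:
  fixes \<mu> :: "real \<Rightarrow> real"
  assumes "k \<ge> 1" and "\<forall>t\<in>{0..T}. 0 \<le> \<mu> t" and "set_integrable lebesgue {0..T} \<mu>"
    and "t \<in> {0..T}" and l: "admissible_intensity l"
  shows "visibility_prob \<mu> k t l = 1 / fact (k - 1) *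
     integral {0..t} (\<lambda>\<tau>. upper_Gamma k (LINT x:{\<tau>..t}|lebesgue. \<mu> x) * intensity_density l t \<tau>)"
  using set_lebesgue_integral_eq_integral(2)[OF integrable_upper_Gamma_intensity_density[OF assms]]
    set_lebesgue_integral_eq_integral(2)[OF admissible_intensity_absolutely_integrable[OF l]]
  by (simp add: visibility_prob_def intensity_density_def mult_ac)

text \<open>The densities are not pointwise concave in the intensity, so only tails are compared:
  \<open>w\<close> is the density of the mixture minus the mixture of the densities, and its tail
  integrals are convexity gaps of \<open>exp\<close>.\<close>

lemma visibility_prob_concave:
  fixes \<mu> :: "real \<Rightarrow> real"
  assumes "k \<ge> 1" and "\<forall>t\<in>{0..T}. 0 \<le> \<mu> t" and "set_integrable lebesgue {0..T} \<mu>"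
    and "t \<in> {0..T}" and l: "admissible_intensity l1" "admissible_intensity l2"
    and \<alpha>: "0 \<le> \<alpha>" "\<alpha> \<le> 1"
  shows "\<alpha> * visibility_prob \<mu> k t l1 + (1 - \<alpha>) * visibility_prob \<mu> k t l2
           \<le> visibility_prob \<mu> k t (\<lambda>x. \<alpha> * l1 x + (1 - \<alpha>) * l2 x)"
proof -
  define l where "l = (\<lambda>x. \<alpha> * l1 x + (1 - \<alpha>) * l2 x)"
  have adm: "admissible_intensity l"
    unfolding l_def using l \<alpha> by (rule admissible_intensity_convex)
  define g where "g = (\<lambda>\<tau>. upper_Gamma k (LINT x:{\<tau>..t}|lebesgue. \<mu> x))"
  define w where "w = (\<lambda>\<tau>. intensity_density l t \<tau> -
      (\<alpha> * intensity_density l1 t \<tau> + (1 - \<alpha>) * intensity_density l2 t \<tau>))"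
  have w: "(w has_integral (\<alpha> * exp (- integral {c..t} l1) + (1 - \<alpha>) * exp (- integral {c..t} l2)
      - exp (- integral {c..t} l))) {c..t}" if "c \<le> t" for c
  proof -
    note D = has_integral_survival_density[OF _ that, folded intensity_density_def]
    have "(w has_integral ((1 - exp (- integral {c..t} l)) -
        (\<alpha> * (1 - exp (- integral {c..t} l1)) + (1 - \<alpha>) * (1 - exp (- integral {c..t} l2))))) {c..t}"
      unfolding w_def by (intro has_integral_diff has_integral_add has_integral_mult_right D adm l)
    then show ?thesis by (simp add: algebra_simps)
  qed
  have "0 \<le> integral {0..t} (\<lambda>\<tau>. g \<tau> * w \<tau>)"
  proof (rule integral_mult_increasing_nonneg)
    show "w integrable_on {0..t}" using w[of 0] assms by auto
    show "0 \<le> t" using assms by simp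
    show "g x \<le> g y" if "0 \<le> x" "x \<le> y" "y \<le> t" for x y
      unfolding g_def using assms that by (intro upper_Gamma_feed_mono[OF assms(1-3)]) auto
    show "0 \<le> g 0"
      unfolding g_def using assms integral_feed_antimono(1)[OF assms(2,3), of 0 0 t]
      by (intro upper_Gamma_nonneg) auto
    \<comment> \<open>The exponent is linear in the intensity, so the sign of the tail is the
      convexity of \<open>exp\<close>.\<close>
    fix c assume c: "c \<in> {0..t}"
    have "integral {c..t} l = \<alpha> * integral {c..t} l1 + (1 - \<alpha>) * integral {c..t} l2"
      unfolding l_def using l
      by (subst Henstock_Kurzweil_Integration.integral_add)
         (auto intro!: integrable_on_cmult_left[where 'b = real, simplified] dest: admissible_intensity_integrable)
    moreover have "exp (- (\<alpha> * x + (1 - \<alpha>) * y)) \<le> \<alpha> * exp (- x) + (1 - \<alpha>) * exp (- y)" for x y :: real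
      using convex_onD[OF exp_convex, of "1 - \<alpha>" "- x" "- y"] \<alpha> by (simp add: algebra_simps)
    ultimately have "exp (- integral {c..t} l)
        \<le> \<alpha> * exp (- integral {c..t} l1) + (1 - \<alpha>) * exp (- integral {c..t} l2)"
      by simp
    then show "0 \<le> integral {c..t} w"
      using w[of c] c by (simp add: integral_unique)
  qed
  also have "(\<lambda>\<tau>. g \<tau> * w \<tau>) = (\<lambda>\<tau>. g \<tau> * intensity_density l t \<tau> -
      (\<alpha> * (g \<tau> * intensity_density l1 t \<tau>) + (1 - \<alpha>) * (g \<tau> * intensity_density l2 t \<tau>)))"
    by (simp add: w_def algebra_simps)
  also have "integral {0..t} \<dots> = integral {0..t} (\<lambda>\<tau>. g \<tau> * intensity_density l t \<tau>) -
      (\<alpha> * integral {0..t} (\<lambda>\<tau>. g \<tau> * intensity_density l1 t \<tau>)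
       + (1 - \<alpha>) * integral {0..t} (\<lambda>\<tau>. g \<tau> * intensity_density l2 t \<tau>))"
  proof -
    have I: "((\<lambda>\<tau>. g \<tau> * intensity_density l' t \<tau>) has_integral
        integral {0..t} (\<lambda>\<tau>. g \<tau> * intensity_density l' t \<tau>)) {0..t}"
      if "admissible_intensity l'" for l'
      using set_lebesgue_integral_eq_integral(1)[OF
          integrable_upper_Gamma_intensity_density[OF assms(1-4) that]]
      unfolding g_def by (rule integrable_integral)
    show ?thesis
      by (intro integral_unique has_integral_diff has_integral_add has_integral_mult_right I adm l)
  qed
  finally show ?thesis
    using visibility_prob_eq[OF assms(1-4)] adm l
    by (simp add: g_def divide_right_mono flip: l_def add_divide_distrib)
qed

section \<open>Boundedness and measurability in time\<close>

text \<open>The weight is at most \<open>upper_Gamma k 0\<close> and the density has mass at most 1.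
  The bound is uniform in \<open>t\<close> and serves as the dominating constant for integration
  over time.\<close>

lemma visibility_prob_bounds:
  fixes \<mu> :: "real \<Rightarrow> real"
  assumes "k \<ge> 1" and "\<forall>t\<in>{0..T}. 0 \<le> \<mu> t" and "set_integrable lebesgue {0..T} \<mu>"
    and "t \<in> {0..T}" and l: "admissible_intensity l"
  shows "0 \<le> visibility_prob \<mu> k t l" "visibility_prob \<mu> k t l \<le> upper_Gamma k 0 / fact (k - 1)"
proof -
  let ?g = "\<lambda>\<tau>. upper_Gamma k (LINT x:{\<tau>..t}|lebesgue. \<mu> x)"
  have int: "(\<lambda>\<tau>. ?g \<tau> * intensity_density l t \<tau>) integrable_on {0..t}"
    using set_lebesgue_integral_eq_integral(1)[OF integrable_upper_Gamma_intensity_density[OF assms]] .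
  have nn: "0 \<le> (LINT x:{\<tau>..t}|lebesgue. \<mu> x)" if "\<tau> \<in> {0..t}" for \<tau>
    using that assms integral_feed_antimono(1)[OF assms(2,3), of \<tau> \<tau> t] by auto
  have 0: "0 \<le> integral {0..t} (\<lambda>\<tau>. ?g \<tau> * intensity_density l t \<tau>)"
    using nn by (intro integral_nonneg[OF int] mult_nonneg_nonneg upper_Gamma_nonneg
        intensity_density_nonneg[OF l]) auto
  then show "0 \<le> visibility_prob \<mu> k t l"
    by (simp add: visibility_prob_eq[OF assms])
  have D: "((\<lambda>\<tau>. upper_Gamma k 0 * intensity_density l t \<tau>) has_integral
      upper_Gamma k 0 * (1 - exp (- integral {0..t} l))) {0..t}"
    unfolding intensity_density_def
    using assms by (intro has_integral_mult_right has_integral_survival_density) auto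
  have "integral {0..t} (\<lambda>\<tau>. ?g \<tau> * intensity_density l t \<tau>)
      \<le> integral {0..t} (\<lambda>\<tau>. upper_Gamma k 0 * intensity_density l t \<tau>)"
    using D nn assms by (intro integral_le int mult_right_mono upper_Gamma_antimono
        intensity_density_nonneg[OF l]) auto
  also have "\<dots> = upper_Gamma k 0 * (1 - exp (- integral {0..t} l))"
    using D by (rule integral_unique)
  also have "\<dots> \<le> upper_Gamma k 0"
    by (simp add: mult_left_le upper_Gamma_nonneg)
  finally show "visibility_prob \<mu> k t l \<le> upper_Gamma k 0 / fact (k - 1)"
    by (simp add: visibility_prob_eq[OF assms] divide_right_mono)
qed

text \<open>Clamping the upper limit to [0,T] extends the primitive continuously, hence as a Borel
  function, to the whole line.\<close>

lemma continuous_on_clamped_integral: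
  fixes h :: "real \<Rightarrow> real"
  assumes "h integrable_on {0..T}" "0 \<le> T"
  shows "continuous_on UNIV (\<lambda>x. integral {0..max 0 (min T x)} h)"
  using assms
  by (intro continuous_on_compose2[OF indefinite_integral_continuous_1[OF assms(1)]]
      continuous_intros) auto

lemma integral_eq_diff_clamped:
  fixes h :: "real \<Rightarrow> real"
  assumes "h integrable_on {0..T}" "0 \<le> \<tau>" "\<tau> \<le> t" "t \<le> T"
  shows "integral {\<tau>..t} h = integral {0..max 0 (min T t)} h - integral {0..max 0 (min T \<tau>)} h"
proof -
  have "h integrable_on {0..t}"
    using assms by (intro integrable_subinterval_real[OF assms(1)]) auto
  then show ?thesis
    using Henstock_Kurzweil_Integration.integral_combine[of 0 \<tau> t h] assms by simp
qed

text \<open>On [0,T] the probability agrees with \<open>F\<close>, a parameter integral over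
  \<open>lborel\<close> of a jointly Borel integrand. \<open>F\<close> is therefore Borel, and being
  bounded on [0,T] it is integrable there.\<close>

lemma visibility_prob_integrable:
  fixes \<mu> :: "real \<Rightarrow> real"
  assumes "T > 0" and k: "k \<ge> 1" and "\<forall>t\<in>{0..T}. 0 \<le> \<mu> t"
    and \<mu>: "set_integrable lebesgue {0..T} \<mu>" and l: "admissible_intensity l"
  shows "set_integrable lebesgue {0..T} (\<lambda>t. visibility_prob \<mu> k t l)"
proof -
  define A where "A = (\<lambda>x. integral {0..max 0 (min T x)} l)"
  define H where "H = (\<lambda>x. integral {0..max 0 (min T x)} \<mu>)"
  \<comment> \<open>Truncation at 0 makes this antitone on all of the line, hence Borel; the
    arguments that matter are nonnegative.\<close>
  define U where "U = (\<lambda>x. upper_Gamma k (max 0 x))"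
  \<comment> \<open>Both moving limits become differences of one-variable primitives, and the domain
    becomes a Borel condition on the pair of times.\<close>
  define F where "F = (\<lambda>t. 1 / fact (k - 1) * (\<integral>\<tau>. (if 0 \<le> \<tau> \<and> \<tau> \<le> t
      then l \<tau> * exp (- (A t - A \<tau>)) * U (H t - H \<tau>) else 0) \<partial>lborel))"
  have \<mu>': "\<mu> integrable_on {0..T}"
    using \<mu> by (rule set_lebesgue_integral_eq_integral)
  have [measurable]: "A \<in> borel_measurable borel" "H \<in> borel_measurable borel"
    unfolding A_def H_def using assms
    by (auto intro!: borel_measurable_continuous_onI continuous_on_clamped_integral
        admissible_intensity_integrable \<mu>')
  have [measurable]: "l \<in> borel_measurable borel"
    using l by (rule admissible_intensity_borel_measurable)
  have "mono (\<lambda>x. - U x)"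
    unfolding mono_def U_def using upper_Gamma_antimono[OF k] by auto
  then have "(\<lambda>x. - (- U x)) \<in> borel_measurable borel"
    by (intro borel_measurable_uminus borel_measurable_mono)
  then have [measurable]: "U \<in> borel_measurable borel" by simp
  have [measurable]: "F \<in> borel_measurable borel"
    unfolding F_def by measurable
  have eq: "visibility_prob \<mu> k t l = F t" if t: "t \<in> {0..T}" for t
  proof -
    \<comment> \<open>The integrands agree at every \<tau>; since the one in \<open>F\<close> is
      Borel, its integrals over \<open>lebesgue\<close> and \<open>lborel\<close> coincide.\<close>
    have "indicator {0..t} \<tau> *\<^sub>R (l \<tau> * exp (- (LINT x:{\<tau>..t}|lebesgue. l x)) *
        upper_Gamma k (LINT x:{\<tau>..t}|lebesgue. \<mu> x)) = (if 0 \<le> \<tau> \<and> \<tau> \<le> t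
        then l \<tau> * exp (- (A t - A \<tau>)) * U (H t - H \<tau>) else 0)" for \<tau>
    proof (cases "\<tau> \<in> {0..t}")
      case True
      then have "set_integrable lebesgue {\<tau>..t} \<mu>"
        using t by (intro set_integrable_subset[OF \<mu>]) auto
      then have "(LINT x:{\<tau>..t}|lebesgue. \<mu> x) = H t - H \<tau>"
        unfolding H_def using integral_eq_diff_clamped[OF \<mu>', of \<tau> t] True t
        by (simp add: set_lebesgue_integral_eq_integral)
      moreover have "(LINT x:{\<tau>..t}|lebesgue. l x) = A t - A \<tau>"
        unfolding A_def
        using integral_eq_diff_clamped[OF admissible_intensity_integrable[OF l], of \<tau> t T] True t
          admissible_intensity_absolutely_integrable[OF l]
        by (simp add: set_lebesgue_integral_eq_integral)
      moreover have "0 \<le> (LINT x:{\<tau>..t}|lebesgue. \<mu> x)"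
        using True t assms by (intro integral_feed_antimono(1)[of T \<mu> \<tau> \<tau>]) auto
      ultimately show ?thesis
        using True by (simp add: U_def)
    qed auto
    then show ?thesis
      unfolding visibility_prob_def F_def set_lebesgue_integral_def
      by (simp add: integral_completion)
  qed
  have "integrable lborel (\<lambda>t. indicator {0..T} t * F t)"
  proof (rule Bochner_Integration.integrable_bound)
    show "integrable lborel (\<lambda>t. indicator {0..T} t * (upper_Gamma k 0 / fact (k - 1)))"
      by (intro integrable_mult_left integrable_real_indicator) (auto simp: emeasure_lborel_Icc_eq)
    show "AE t in lborel. norm (indicator {0..T} t * F t)
        \<le> norm (indicator {0..T} t * (upper_Gamma k 0 / fact (k - 1)))"
      using visibility_prob_bounds[OF k assms(3) \<mu> _ l] upper_Gamma_nonneg[of 0 k] eq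
      by (auto split: split_indicator)
  qed measurable
  then have "set_integrable lebesgue {0..T} F"
    unfolding set_integrable_def by (simp add: integrable_completion)
  then show ?thesis
    by (subst set_integrable_cong[OF refl refl eq]) auto
qed

section \<open>Locality in the intensity and concavity of the expected visibility\<close>

lemma visibility_prob_cong:
  assumes "\<And>x. x \<in> {0..t} \<Longrightarrow> l x = l' x"
  shows "visibility_prob \<mu> k t l = visibility_prob \<mu> k t l'"
proof -
  have "(LINT x:{\<tau>..t}|lebesgue. l x) = (LINT x:{\<tau>..t}|lebesgue. l' x)" if "\<tau> \<in> {0..t}" for \<tau>
    using assms that by (intro set_lebesgue_integral_cong) auto
  then show ?thesis
    unfolding visibility_prob_def using assms
    by (auto intro!: set_lebesgue_integral_cong)
qed

lemma visibility_cong: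
  assumes "\<And>x. x \<in> {0..T} \<Longrightarrow> l x = l' x"
  shows "visibility T \<mu> k l = visibility T \<mu> k l'"
  unfolding visibility_def using assms
  by (auto intro!: set_lebesgue_integral_cong visibility_prob_cong)

text \<open>Integrates the pointwise inequality; linearity and monotonicity of the integral rest on
  integrability in \<open>t\<close> for both intensities and their mixture.\<close>

lemma visibility_concave:
  fixes \<mu> :: "real \<Rightarrow> real"
  assumes "T > 0" "k \<ge> 1" and "\<forall>t\<in>{0..T}. 0 \<le> \<mu> t" and "set_integrable lebesgue {0..T} \<mu>"
    and l: "admissible_intensity l1" "admissible_intensity l2"
    and \<alpha>: "0 \<le> \<alpha>" "\<alpha> \<le> 1"
  shows "\<alpha> * visibility T \<mu> k l1 + (1 - \<alpha>) * visibility T \<mu> k l2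
           \<le> visibility T \<mu> k (\<lambda>x. \<alpha> * l1 x + (1 - \<alpha>) * l2 x)"
proof -
  note I = visibility_prob_integrable[OF assms(1-4)]
  have "\<alpha> * visibility T \<mu> k l1 + (1 - \<alpha>) * visibility T \<mu> k l2 =
      (LINT t:{0..T}|lebesgue. \<alpha> * visibility_prob \<mu> k t l1 + (1 - \<alpha>) * visibility_prob \<mu> k t l2)"
    unfolding visibility_def using I l by simp
  also have "\<dots> \<le> visibility T \<mu> k (\<lambda>x. \<alpha> * l1 x + (1 - \<alpha>) * l2 x)"
    unfolding visibility_def
    by (intro set_integral_mono set_integral_add(1) set_integrable_mult_right impI I l
        admissible_intensity_convex \<alpha> visibility_prob_concave[OF assms(2-4)])
  finally show ?thesis .
qed

section \<open>Transfer to piecewise constant intensities\<close>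

text \<open>The witness is the step formula itself, read on the whole line: it is bounded by the sum
  of the \<open>a m\<close> and can jump only at breakpoints.\<close>

lemma piecewise_constant_intensities_admissible:
  assumes "l \<in> piecewise_constant_intensities T M"
  obtains l' where "admissible_intensity l'" "\<And>x. x \<in> {0..T} \<Longrightarrow> l x = l' x"
proof -
  obtain a :: "nat \<Rightarrow> real" where a: "\<forall>m\<in>{1..M}. 0 \<le> a m"
    and l: "\<forall>t\<in>{0..T}. l t =
      (\<Sum>m = 1..M. a m * indicator {breakpoint T M (m - 1)..<breakpoint T M m} t)"
    using assms unfolding piecewise_constant_intensities_def by blast
  let ?l = "\<lambda>t. \<Sum>m = 1..M. a m * indicator {breakpoint T M (m - 1)..<breakpoint T M m} t"
  \<comment> \<open>Index 0 is included as the left end of the first piece.\<close>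
  let ?S = "breakpoint T M ` {0..M}"
  have "continuous_on (- ?S) ?l"
  proof (intro continuous_on_sum continuous_on_mult_left)
    fix m assume m: "m \<in> {1..M}"
    have "isCont (indicator {breakpoint T M (m - 1)..<breakpoint T M m} :: real \<Rightarrow> real) x"
      if "x \<notin> ?S" for x
    proof -
      have "x \<noteq> breakpoint T M (m - 1)" "x \<noteq> breakpoint T M m"
        using that m by auto
      \<comment> \<open>A nonempty piece has its two endpoints as frontier; an empty one has
        none.\<close>
      then have "x \<notin> frontier {breakpoint T M (m - 1)..<breakpoint T M m}"
        by (cases "breakpoint T M (m - 1) < breakpoint T M m") (auto simp: frontier_def)
      then show ?thesis
        by (simp add: isCont_indicator)
    qed
    then show "continuous_on (- ?S) (\<lambda>t. indicator {breakpoint T M (m - 1)..<breakpoint T M m} t :: real)"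
      by (intro continuous_at_imp_continuous_on) auto
  qed
  moreover have "?l t \<le> (\<Sum>m = 1..M. a m)" for t
    using a by (intro sum_mono) (auto split: split_indicator)
  moreover have "0 \<le> ?l t" for t
    using a by (intro sum_nonneg) auto
  ultimately have "admissible_intensity ?l"
    unfolding admissible_intensity_def by blast
  then show thesis
    using that l by blast
qed

text \<open>Serves both functionals: each intensity is replaced by an admissible one equal to it on
  [0,T], and the mixtures then agree there too.\<close>

lemma concave_functional_piecewise_constant:
  assumes cong: "\<And>l l'. (\<And>x. x \<in> {0..T} \<Longrightarrow> l x = l' x) \<Longrightarrow> J l = J l'"
    and conc: "\<And>l1 l2 \<alpha>. \<lbrakk>admissible_intensity l1; admissible_intensity l2; 0 \<le> \<alpha>; \<alpha> \<le> 1\<rbrakk>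
        \<Longrightarrow> \<alpha> * J l1 + (1 - \<alpha>) * J l2 \<le> J (\<lambda>x. \<alpha> * l1 x + (1 - \<alpha>) * l2 x)"
  shows "concave_functional (piecewise_constant_intensities T M) J"
  unfolding concave_functional_def
proof (intro ballI allI impI)
  fix g1 g2 and \<alpha> :: real
  assume g: "g1 \<in> piecewise_constant_intensities T M" "g2 \<in> piecewise_constant_intensities T M"
    and \<alpha>: "0 < \<alpha> \<and> \<alpha> < 1"
  obtain l1 where l1: "admissible_intensity l1" "\<And>x. x \<in> {0..T} \<Longrightarrow> g1 x = l1 x"
    using piecewise_constant_intensities_admissible[OF g(1)] by blast
  obtain l2 where l2: "admissible_intensity l2" "\<And>x. x \<in> {0..T} \<Longrightarrow> g2 x = l2 x"
    using piecewise_constant_intensities_admissible[OF g(2)] by blast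
  have "J g1 = J l1" "J g2 = J l2"
    "J (\<lambda>x. \<alpha> * g1 x + (1 - \<alpha>) * g2 x) = J (\<lambda>x. \<alpha> * l1 x + (1 - \<alpha>) * l2 x)"
    using l1(2) l2(2) by (auto intro!: cong)
  then show "J (\<lambda>x. \<alpha> * g1 x + (1 - \<alpha>) * g2 x) \<ge> \<alpha> * J g1 + (1 - \<alpha>) * J g2"
    using conc[OF l1(1) l2(1), of \<alpha>] \<alpha> by simp
qed

theorem theorem7:
  fixes T :: real and M k :: nat and \<mu> :: "real \<Rightarrow> real"
  assumes "T > 0" and "M \<ge> 1" and "k \<ge> 1"
    and "\<forall>t\<in>{0..T}. 0 \<le> \<mu> t"
    and "set_integrable lebesgue {0..T} \<mu>"
  shows "(\<forall>t\<in>{0..T}. concave_functional (piecewise_constant_intensities T M)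
             (\<lambda>l. visibility_prob \<mu> k t l)) \<and>
         concave_functional (piecewise_constant_intensities T M)
             (\<lambda>l. visibility T \<mu> k l)"
proof (intro conjI ballI concave_functional_piecewise_constant)
  fix t and l l' :: "real \<Rightarrow> real"
  assume "t \<in> {0..T}" "\<And>x. x \<in> {0..T} \<Longrightarrow> l x = l' x"
  then show "visibility_prob \<mu> k t l = visibility_prob \<mu> k t l'"
    by (intro visibility_prob_cong) auto
qed (use assms in \<open>blast intro: visibility_cong visibility_prob_concave visibility_concave\<close>)+

end
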